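(* $F_{\mathrm{strong}}\not\preceq\mathrm{WL}_{3/2}$: there exist graphs $G$ and $H$ with $\mathrm{WL}_{3/2}(G)=\mathrm{WL}_{3/2}(H)$ but $F_{\mathrm{strong}}(G)\ne F_{\mathrm{strong}}(H)$. Consequently also $F_{\mathrm{weak}}$ is strictly weaker than $F_{\mathrm{strong}}$ (there are graphs with equal $F_{\mathrm{weak}}$ and different $F_{\mathrm{strong}}$).
   Context: Graphs are finite, simple and undirected with adjacency matrix $A$. $\mathrm{Spec}(G)$ is the multiset of eigenvalues of $A$. Let $\mu_1<\dots<\mu_m$ be the distinct eigenvalues, $P_i$ the orthogonal projection matrix onto the eigenspace of $\mu_i$, $P_*(x,y)=(P_1(x,y),\dots,P_m(x,y))$. Fürer's strong spectral invariant is $F_{\mathrm{strong}}(G)=\big(\mathrm{Spec}(G),\{\!\{(P_*(x,x),\{\!\{(P_*(x,y),P_*(y,y))\}\!\}_{y\in V(G)})\}\!\}_{x\in V(G)}\big)$ and the weak one is $F_{\mathrm{weak}}(G)=\big(\mathrm{Spec}(G),\{\!\{(P_*(x,x),\{\!\{P_*(x,y)\}\!\}_{y})\}\!\}_{x}\big)$, where $\{\!\{\cdot\}\!\}$ denotes a multiset. Color refinement (1-WL) on a vertex-colored $n$-vertex graph: $C^0(x)$ is the color of $x$ (uniform if uncolored), $C^{r+1}(x)=\big(C^r(x),\{\!\{C^r(y)\}\!\}_{y\in N(x)}\big)$; $\mathrm{WL}_1(G)=\{\!\{C^n(x)\}\!\}_{x\in V(G)}$. $G_x$ is $G$ with vertex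 $x$ individualized (given a special new color, the same for all choices of $x$). $\mathrm{WL}_{3/2}(G)=\{\!\{\mathrm{WL}_1(G_x)\}\!\}_{x\in V(G)}$. *)

theory Defs
  imports "Jordan_Normal_Form.Char_Poly" "HOL-Library.Multiset"
begin

text \<open>A finite simple graph on the vertex set {0..<n}: a pair (n, E) where the
  adjacency relation E is symmetric and irreflexive on {0..<n}
  (values of E outside {0..<n} are irrelevant to all invariants below).\<close>

type_synonym graph = "nat \<times> (nat \<Rightarrow> nat \<Rightarrow> bool)"

definition is_graph :: "graph \<Rightarrow> bool" where
  "is_graph G = (\<forall>x<fst G. \<forall>y<fst G. (snd G x y \<longleftrightarrow> snd G y x) \<and> \<not> snd G x x)"

definition verts :: "graph \<Rightarrow> nat set" where
  "verts G = {0..<fst G}"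

definition nbrs :: "graph \<Rightarrow> nat \<Rightarrow> nat set" where
  "nbrs G x = {y \<in> verts G. snd G x y}"

definition adj_mat :: "graph \<Rightarrow> real mat" where
  "adj_mat G = mat (fst G) (fst G) (\<lambda>(i, j). if snd G i j then 1 else 0)"

definition Spec :: "graph \<Rightarrow> real multiset" where
  "Spec G = proots (char_poly (adj_mat G))"

definition distinct_eigs :: "graph \<Rightarrow> real list" where
  "distinct_eigs G = sorted_list_of_set (set_mset (Spec G))"

definition eigenspace :: "graph \<Rightarrow> real \<Rightarrow> real vec set" where
  "eigenspace G \<mu> = {v \<in> carrier_vec (fst G). adj_mat G *\<^sub>v v = \<mu> \<cdot>\<^sub>v v}"

definition eig_proj :: "graph \<Rightarrow> real \<Rightarrow> real mat" where
  "eig_proj G \<mu> = (THE P. P \<in> carrier_mat (fst G) (fst G) \<and>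
     (\<forall>v \<in> carrier_vec (fst G). P *\<^sub>v v \<in> eigenspace G \<mu> \<and>
        (\<forall>w \<in> eigenspace G \<mu>. (v - P *\<^sub>v v) \<bullet> w = 0)))"

definition Pstar :: "graph \<Rightarrow> nat \<Rightarrow> nat \<Rightarrow> real list" where
  "Pstar G x y = map (\<lambda>\<mu>. eig_proj G \<mu> $$ (x, y)) (distinct_eigs G)"

definition F_strong :: "graph \<Rightarrow> real multiset \<times> (real list \<times> (real list \<times> real list) multiset) multiset" where
  "F_strong G = (Spec G,
     image_mset (\<lambda>x. (Pstar G x x, image_mset (\<lambda>y. (Pstar G x y, Pstar G y y)) (mset_set (verts G))))
       (mset_set (verts G)))"

definition F_weak :: "graph \<Rightarrow> real multiset \<times> (real list \<times> real list multiset) multiset" where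
  "F_weak G = (Spec G,
     image_mset (\<lambda>x. (Pstar G x x, image_mset (\<lambda>y. Pstar G x y) (mset_set (verts G))))
       (mset_set (verts G)))"

datatype color = Init nat | Refine color "color multiset"

fun cr_color :: "graph \<Rightarrow> (nat \<Rightarrow> nat) \<Rightarrow> nat \<Rightarrow> nat \<Rightarrow> color" where
  "cr_color G c 0 x = Init (c x)"
| "cr_color G c (Suc r) x =
     Refine (cr_color G c r x) (image_mset (cr_color G c r) (mset_set (nbrs G x)))"

definition WL1 :: "graph \<Rightarrow> (nat \<Rightarrow> nat) \<Rightarrow> color multiset" where
  "WL1 G c = image_mset (cr_color G c (fst G)) (mset_set (verts G))"

definition indiv :: "nat \<Rightarrow> nat \<Rightarrow> nat" where
  "indiv x = (\<lambda>y. if y = x then 1 else 0)"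

definition WL32 :: "graph \<Rightarrow> color multiset multiset" where
  "WL32 G = image_mset (\<lambda>x. WL1 G (indiv x)) (mset_set (verts G))"

end

theory Submission
  imports Defs
begin

text \<open>Replace every vertex of a graph \<open>B\<close> by a \<open>d\<close>-regular graph on \<open>m\<close> vertices, its fibre, and every edge
  by a complete join. After individualizing a vertex, color refinement resolves at most the fibre of this
  vertex and sees all other fibres just as \<open>d\<close>-regular graphs. The same is true for the entries \<open>P\<^sub>*(x, y)\<close>
  with fixed \<open>x\<close>: the vectors with zero sum on every fibre and the vectors that are constant on fibres are
  invariant, and only the part of the first space that lives on the fibre of \<open>x\<close> contributes anything that
  depends on the fibres. Hence, if \<open>B\<close> is vertex-transitive, neither \<open>WL32\<close> nor \<open>F_weak\<close> changes when the
  fibres are permuted.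

  Now let \<open>B\<close> consist of two disjoint edges, and put hexagons on two of its vertices and pairs of triangles
  on the other two. The diagonal entries \<open>P\<^sub>*(y, y)\<close> tell the two kinds of fibres apart, and \<open>P\<^sub>*(x, y)\<close>
  tells whether \<open>x\<close> and \<open>y\<close> lie over the same edge. So \<open>F_strong\<close> sees whether the edges of \<open>B\<close> join fibres
  of the same kind.\<close>

section \<open>Color refinement\<close>

lemma image_mset_eq_if_refines:
  assumes "image_mset p M = image_mset q N"
    and "\<And>a b. a \<in># M \<Longrightarrow> b \<in># N \<Longrightarrow> p a = q b \<Longrightarrow> f a = g b"
  shows "image_mset f M = image_mset g N"
proof -
  have "rel_mset (=) (image_mset p M) (image_mset q N)"
    using assms(1) by (simp add: multiset.rel_eq)
  then have "rel_mset (\<lambda>a b. p a = q b) M N"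
    by (simp add: multiset.rel_map)
  then have "rel_mset (\<lambda>a b. f a = g b) M N"
    by (rule multiset.rel_mono_strong) (use assms(2) in auto)
  then have "rel_mset (=) (image_mset f M) (image_mset g N)"
    by (simp add: multiset.rel_map)
  then show ?thesis
    by (simp add: multiset.rel_eq)
qed

lemma mset_set_bij_betw:
  assumes "bij_betw h A B"
  shows "mset_set B = image_mset h (mset_set A)"
  using assms by (simp add: bij_betw_def image_mset_mset_set)

lemma mem_verts [simp]: "x \<in> verts G \<longleftrightarrow> x < fst G"
  by (simp add: verts_def)

lemma finite_verts [simp]: "finite (verts G)"
  by (simp add: verts_def)

lemma mem_nbrs [simp]: "y \<in> nbrs G x \<longleftrightarrow> y < fst G \<and> snd G x y"
  by (simp add: nbrs_def)

lemma finite_nbrs [simp]: "finite (nbrs G x)"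
  by (simp add: nbrs_def)

lemma sum_nbrs: "(\<Sum>y\<in>nbrs G x. f y) = (\<Sum>y<fst G. if snd G x y then f y else 0)"
  unfolding nbrs_def verts_def atLeast0LessThan by (rule sum.inter_filter) simp

lemma card_nbrs: "card (nbrs G x) = (\<Sum>y<fst G. if snd G x y then 1 else 0)"
  using sum_nbrs[of "\<lambda>_. 1 :: nat" G x] by simp

definition is_regular :: "nat \<Rightarrow> graph \<Rightarrow> bool" where
  "is_regular d G \<longleftrightarrow> is_graph G \<and> (\<forall>x\<in>verts G. card (nbrs G x) = d)"

definition graph_iso :: "(nat \<Rightarrow> nat) \<Rightarrow> graph \<Rightarrow> graph \<Rightarrow> bool" where
  "graph_iso h G H \<longleftrightarrow> bij_betw h (verts G) (verts H) \<and>
     (\<forall>x\<in>verts G. \<forall>y\<in>verts G. snd G x y \<longleftrightarrow> snd H (h x) (h y))"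

definition vertex_transitive :: "graph \<Rightarrow> bool" where
  "vertex_transitive G \<longleftrightarrow> (\<forall>x\<in>verts G. \<forall>y\<in>verts G. \<exists>\<sigma>. graph_iso \<sigma> G G \<and> \<sigma> x = y)"

lemma graph_iso_nbrs:
  assumes "graph_iso h G H" "x < fst G"
  shows "bij_betw h (nbrs G x) (nbrs H (h x))"
proof -
  have h: "bij_betw h (verts G) (verts H)" "\<And>y. y < fst G \<Longrightarrow> snd H (h x) (h y) \<longleftrightarrow> snd G x y"
    using assms by (auto simp: graph_iso_def)
  have "nbrs H (h x) = {z \<in> h ` verts G. snd H (h x) z}"
    by (simp add: nbrs_def bij_betw_imp_surj_on[OF h(1)])
  also have "\<dots> = h ` nbrs G x"
    using h(2) by auto
  finally have "h ` nbrs G x = nbrs H (h x)" ..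
  then show ?thesis
    using h(1) by (auto simp: bij_betw_def elim: inj_on_subset)
qed

lemma graph_iso_verts:
  assumes "graph_iso h G H"
  shows "fst G = fst H" "x < fst G \<Longrightarrow> h x < fst H"
proof -
  have h: "bij_betw h (verts G) (verts H)"
    using assms by (simp add: graph_iso_def)
  from bij_betw_same_card[OF h] show "fst G = fst H"
    by (simp add: verts_def)
  show "x < fst G \<Longrightarrow> h x < fst H"
    using bij_betwE[OF h] by simp
qed

definition jointly_equitable :: "graph \<Rightarrow> (nat \<Rightarrow> 'a) \<Rightarrow> graph \<Rightarrow> (nat \<Rightarrow> 'a) \<Rightarrow> bool" where
  "jointly_equitable G p H q \<longleftrightarrow> (\<forall>x\<in>verts G. \<forall>y\<in>verts H. p x = q y \<longrightarrow>
     image_mset p (mset_set (nbrs G x)) = image_mset q (mset_set (nbrs H y)))"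

lemma cr_color_eq_if_jointly_equitable:
  assumes "jointly_equitable G p H q"
    and init: "\<And>x y. x < fst G \<Longrightarrow> y < fst H \<Longrightarrow> p x = q y \<Longrightarrow> c x = d y"
    and "x < fst G" "y < fst H" "p x = q y"
  shows "cr_color G c r x = cr_color H d r y"
  using assms(3-5)
proof (induction r arbitrary: x y)
  case 0
  then show ?case using init by simp
next
  case (Suc r)
  have "image_mset p (mset_set (nbrs G x)) = image_mset q (mset_set (nbrs H y))"
    using assms(1) Suc.prems by (simp add: jointly_equitable_def)
  then have "image_mset (cr_color G c r) (mset_set (nbrs G x)) =
      image_mset (cr_color H d r) (mset_set (nbrs H y))"
    by (rule image_mset_eq_if_refines) (simp add: Suc.IH)
  then show ?case using Suc by simp
qed

lemma WL1_eq_if_jointly_equitable: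
  assumes "jointly_equitable G p H q" "fst G = fst H"
    and "\<And>x y. x < fst G \<Longrightarrow> y < fst H \<Longrightarrow> p x = q y \<Longrightarrow> c x = d y"
    and "image_mset p (mset_set (verts G)) = image_mset q (mset_set (verts H))"
  shows "WL1 G c = WL1 H d"
  unfolding WL1_def using assms(4)
proof (rule image_mset_eq_if_refines)
  fix x y assume "x \<in># mset_set (verts G)" "y \<in># mset_set (verts H)" "p x = q y"
  then show "cr_color G c (fst G) x = cr_color H d (fst H) y"
    unfolding assms(2)[symmetric]
    by (intro cr_color_eq_if_jointly_equitable[OF assms(1,3)]) simp_all
qed

lemma WL1_iso:
  assumes iso: "graph_iso h G H" and color: "\<And>x. x < fst G \<Longrightarrow> c x = d (h x)"
  shows "WL1 G c = WL1 H d"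
proof (rule WL1_eq_if_jointly_equitable[where p = h and q = id])
  have h: "bij_betw h (verts G) (verts H)"
    using iso by (simp add: graph_iso_def)
  show "jointly_equitable G h H id"
    using graph_iso_nbrs[OF iso] mset_set_bij_betw by (fastforce simp: jointly_equitable_def)
  show "fst G = fst H"
    by (rule graph_iso_verts(1)[OF iso])
  show "image_mset h (mset_set (verts G)) = image_mset id (mset_set (verts H))"
    using mset_set_bij_betw[OF h] by simp
qed (simp add: color)

lemma WL1_indiv_iso:
  assumes "graph_iso h G H" "x < fst G"
  shows "WL1 G (indiv x) = WL1 H (indiv (h x))"
proof (rule WL1_iso[OF assms(1)])
  have "inj_on h (verts G)"
    using assms(1) by (simp add: graph_iso_def bij_betw_def)
  then show "indiv x y = indiv (h x) (h y)" if "y < fst G" for y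
    using that assms(2) by (simp add: indiv_def inj_on_eq_iff)
qed

section \<open>Multiplicities of eigenvalues\<close>

lemma linear_power_Suc_order_dvd:
  fixes p :: "'a :: field_char_0 poly"
  shows "[:-a, 1:] ^ Suc (order a p) dvd [:-a, 1:] * pderiv p - Polynomial.smult (of_nat (order a p)) p"
proof -
  define X k where "X = [:-a, 1:]" and "k = order a p"
  obtain q where p: "p = X ^ k * q"
    using order_1[of a p] by (auto simp: X_def k_def)
  have "pderiv X = 1" by (simp add: X_def pderiv_pCons)
  then have "X * pderiv (X ^ k) = Polynomial.smult (of_nat k) (X ^ k)"
    by (cases k) (simp_all del: power_Suc of_nat_Suc add: pderiv_power_Suc, simp)
  moreover have "X * pderiv p = X ^ Suc k * pderiv q + q * (X * pderiv (X ^ k))"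
    by (simp add: p pderiv_mult algebra_simps)
  ultimately have "X * pderiv p = X ^ Suc k * pderiv q + Polynomial.smult (of_nat k) p"
    by (simp add: p mult.commute)
  then show ?thesis by (simp add: X_def k_def)
qed

lemma linear_power_dvd_cancel:
  fixes p :: "'a :: idom poly"
  assumes "a \<noteq> c" "[:-a, 1:] ^ k dvd [:-c, 1:] * p"
  shows "[:-a, 1:] ^ k dvd p"
proof (cases "p = 0")
  case False
  define X where "X = [:-c, 1:]"
  have "order a X = 0" "X \<noteq> 0"
    using assms(1) by (auto simp: X_def intro: order_0I)
  then show ?thesis
    using False assms(2)[folded X_def] by (simp add: order_divides order_mult)
qed simp

text \<open>The hypotheses say that \<open>p' / p\<close> is the sum of the fractions \<open>\<tau> \<nu> / (x - \<nu>)\<close>, where \<open>b \<nu>\<close> is the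
  product of \<open>p\<close> and the fraction for \<open>\<nu>\<close>.\<close>

lemma order_eq_logarithmic_residue:
  fixes p :: "'a :: field_char_0 poly"
  assumes "p \<noteq> 0" "finite M"
    and pderiv: "pderiv p = (\<Sum>\<nu>\<in>M. b \<nu>)"
    and residue: "\<And>\<nu>. \<nu> \<in> M \<Longrightarrow> [:-\<nu>, 1:] * b \<nu> = Polynomial.smult (\<tau> \<nu>) p"
  shows "of_nat (order \<mu> p) = (if \<mu> \<in> M then \<tau> \<mu> else 0)"
proof (rule ccontr)
  define X where "X \<nu> = [:-\<nu>, 1:]" for \<nu> :: 'a
  define k t where "k = order \<mu> p" and "t = (if \<mu> \<in> M then \<tau> \<mu> else 0)"
  assume "of_nat (order \<mu> p) \<noteq> (if \<mu> \<in> M then \<tau> \<mu> else 0)"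
  then have residue_neq: "t - of_nat k \<noteq> 0" by (simp add: k_def t_def)
  have "X \<mu> ^ Suc k dvd X \<mu> * pderiv p - Polynomial.smult (of_nat k) p"
    unfolding X_def k_def by (rule linear_power_Suc_order_dvd)
  moreover have "X \<mu> ^ Suc k dvd X \<mu> * pderiv p - Polynomial.smult t p"
  proof -
    have "X \<mu> ^ k dvd b \<nu>" if "\<nu> \<in> M - {\<mu>}" for \<nu>
    proof -
      have "X \<mu> ^ k dvd X \<nu> * b \<nu>"
        using residue that order_1[of \<mu> p] by (simp add: X_def k_def dvd_smult)
      then show ?thesis
        unfolding X_def by (rule linear_power_dvd_cancel[rotated]) (use that in auto)
    qed
    then have "X \<mu> ^ Suc k dvd (\<Sum>\<nu>\<in>M - {\<mu>}. X \<mu> * b \<nu>)"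
      by (intro dvd_sum) (simp add: mult_dvd_mono)
    moreover have "X \<mu> * pderiv p = (\<Sum>\<nu>\<in>M - {\<mu>}. X \<mu> * b \<nu>) + Polynomial.smult t p"
      using assms(2) residue[of \<mu>, folded X_def]
      by (cases "\<mu> \<in> M") (simp_all add: pderiv t_def sum.remove distrib_left sum_distrib_left)
    ultimately show ?thesis by simp
  qed
  ultimately have "X \<mu> ^ Suc k dvd
      (X \<mu> * pderiv p - Polynomial.smult (of_nat k) p) - (X \<mu> * pderiv p - Polynomial.smult t p)"
    by (rule dvd_diff)
  also have "\<dots> = Polynomial.smult (t - of_nat k) p"
    by (simp add: smult_diff_left)
  finally have "X \<mu> ^ Suc k dvd p"
    using residue_neq by (rule dvd_smult_cancel)
  then show False
    using order_2[OF assms(1), of \<mu>] by (simp only: X_def k_def)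
qed

lemma pderiv_char_poly_eq_trace_adj_mat:
  fixes A :: "'a :: idom mat"
  assumes "A \<in> carrier_mat n n"
  shows "pderiv (char_poly A) = (\<Sum>i<n. Determinant.adj_mat (char_poly_matrix A) $$ (i, i))"
proof -
  have "Determinant.adj_mat (char_poly_matrix A) $$ (i, i) = char_poly (mat_delete A i i)" if "i < n" for i
  proof -
    have "mat_delete (char_poly_matrix A) i i = char_poly_matrix (mat_delete A i i)"
      using assms that by (intro eq_matI) (auto simp: char_poly_matrix_def mat_delete_def)
    then show ?thesis
      using assms that by (simp add: Determinant.adj_mat_def cofactor_def char_poly_def char_poly_matrix_def)
  qed
  then show ?thesis by (simp add: pderiv_char_poly[OF assms])
qed

abbreviation const_poly_mat :: "'a :: zero mat \<Rightarrow> 'a poly mat" where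
  "const_poly_mat \<equiv> map_mat (\<lambda>a. [:a:])"

lemma char_poly_matrix_mult_eigenmatrix:
  fixes A :: "'a :: comm_ring_1 mat"
  assumes A: "A \<in> carrier_mat n n" and P: "P \<in> carrier_mat n n" and "A * P = \<nu> \<cdot>\<^sub>m P"
  shows "char_poly_matrix A * const_poly_mat P = [:-\<nu>, 1:] \<cdot>\<^sub>m const_poly_mat P"
proof -
  interpret const: comm_ring_hom "\<lambda>a :: 'a. [:a:]"
    by unfold_locales (auto simp: one_pCons)
  have "char_poly_matrix A = [:0, 1:] \<cdot>\<^sub>m 1\<^sub>m n - const_poly_mat A"
    using A by (intro eq_matI) (auto simp: char_poly_matrix_def)
  then have "char_poly_matrix A * const_poly_mat P =
      ([:0, 1:] \<cdot>\<^sub>m 1\<^sub>m n) * const_poly_mat P - const_poly_mat A * const_poly_mat P"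
    using A P by (simp add: minus_mult_distrib_mat[of _ n n])
  also have "const_poly_mat A * const_poly_mat P = const_poly_mat (\<nu> \<cdot>\<^sub>m P)"
    using const.mat_hom_mult[OF A P] assms(3) by simp
  also have "([:0, 1:] \<cdot>\<^sub>m 1\<^sub>m n) * const_poly_mat P - const_poly_mat (\<nu> \<cdot>\<^sub>m P) =
      [:-\<nu>, 1:] \<cdot>\<^sub>m const_poly_mat P"
    using P by (intro eq_matI) (auto simp: mult_smult_assoc_mat[of _ n n])
  finally show ?thesis .
qed

lemma adj_mat_char_poly_matrix_mult_eigenmatrix:
  fixes A :: "'a :: idom mat"
  assumes A: "A \<in> carrier_mat n n" and P: "P \<in> carrier_mat n n" and eigen: "A * P = \<nu> \<cdot>\<^sub>m P"
  shows "[:-\<nu>, 1:] \<cdot>\<^sub>m (Determinant.adj_mat (char_poly_matrix A) * const_poly_mat P) =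
    char_poly A \<cdot>\<^sub>m const_poly_mat P"
proof -
  define C B where "C = char_poly_matrix A" and "B = Determinant.adj_mat C"
  have C: "C \<in> carrier_mat n n" and B: "B \<in> carrier_mat n n" and R: "const_poly_mat P \<in> carrier_mat n n"
    using A P by (simp_all add: C_def B_def Determinant.adj_mat(1))
  have "[:-\<nu>, 1:] \<cdot>\<^sub>m (B * const_poly_mat P) = B * (C * const_poly_mat P)"
    using mult_smult_distrib[OF B R] char_poly_matrix_mult_eigenmatrix[OF assms] by (simp add: C_def)
  also have "\<dots> = (B * C) * const_poly_mat P"
    by (rule assoc_mult_mat[OF B C R, symmetric])
  also have "\<dots> = char_poly A \<cdot>\<^sub>m const_poly_mat P"
    using Determinant.adj_mat(3)[OF C] mult_smult_assoc_mat[OF one_carrier_mat R] left_mult_one_mat[OF R]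
    by (simp add: B_def C_def char_poly_def)
  finally show ?thesis by (simp add: B_def C_def)
qed

lemma sum_diag_mult_resolution:
  fixes B :: "'a :: comm_semiring_1 poly mat" and P :: "'b \<Rightarrow> 'a mat"
  assumes B: "B \<in> carrier_mat n n" and P: "\<And>\<nu>. \<nu> \<in> M \<Longrightarrow> P \<nu> \<in> carrier_mat n n"
    and resolution: "\<And>i j. i < n \<Longrightarrow> j < n \<Longrightarrow> (\<Sum>\<nu>\<in>M. P \<nu> $$ (i, j)) = of_bool (i = j)"
    and i: "i < n"
  shows "(\<Sum>\<nu>\<in>M. (B * const_poly_mat (P \<nu>)) $$ (i, i)) = B $$ (i, i)"
proof -
  have "(B * const_poly_mat (P \<nu>)) $$ (i, i) = (\<Sum>j<n. Polynomial.smult (P \<nu> $$ (j, i)) (B $$ (i, j)))"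
    if "\<nu> \<in> M" for \<nu>
    using i B P[OF that] by (simp add: scalar_prod_def atLeast0LessThan)
  then have "(\<Sum>\<nu>\<in>M. (B * const_poly_mat (P \<nu>)) $$ (i, i)) =
      (\<Sum>j<n. Polynomial.smult (\<Sum>\<nu>\<in>M. P \<nu> $$ (j, i)) (B $$ (i, j)))"
    by (simp add: smult_sum sum.swap[of _ _ M])
  also have "\<dots> = (\<Sum>j<n. if j = i then B $$ (i, j) else 0)"
    using i by (intro sum.cong) (auto simp: resolution)
  finally show ?thesis using i by simp
qed

lemma order_char_poly_eq_trace:
  fixes A :: "'a :: field_char_0 mat"
  assumes A: "A \<in> carrier_mat n n" and "finite M"
    and P: "\<And>\<nu>. \<nu> \<in> M \<Longrightarrow> P \<nu> \<in> carrier_mat n n"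
    and eigen: "\<And>\<nu>. \<nu> \<in> M \<Longrightarrow> A * P \<nu> = \<nu> \<cdot>\<^sub>m P \<nu>"
    and resolution: "\<And>i j. i < n \<Longrightarrow> j < n \<Longrightarrow> (\<Sum>\<nu>\<in>M. P \<nu> $$ (i, j)) = of_bool (i = j)"
  shows "of_nat (order \<mu> (char_poly A)) = (if \<mu> \<in> M then \<Sum>i<n. P \<mu> $$ (i, i) else 0)"
proof (rule order_eq_logarithmic_residue)
  let ?B = "Determinant.adj_mat (char_poly_matrix A)"
  let ?b = "\<lambda>\<nu>. \<Sum>i<n. (?B * const_poly_mat (P \<nu>)) $$ (i, i)"
  have B: "?B \<in> carrier_mat n n"
    using A by (simp add: Determinant.adj_mat(1))
  show "char_poly A \<noteq> 0"
    using degree_monic_char_poly[OF A] by auto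
  show "pderiv (char_poly A) = (\<Sum>\<nu>\<in>M. ?b \<nu>)"
    using sum_diag_mult_resolution[OF B P resolution]
    by (subst sum.swap) (simp add: pderiv_char_poly_eq_trace_adj_mat[OF A])
  show "[:-\<nu>, 1:] * ?b \<nu> = Polynomial.smult (\<Sum>i<n. P \<nu> $$ (i, i)) (char_poly A)" if \<nu>: "\<nu> \<in> M" for \<nu>
  proof -
    note adjugate_eq = adj_mat_char_poly_matrix_mult_eigenmatrix[OF A P[OF \<nu>] eigen[OF \<nu>]]
    have "[:-\<nu>, 1:] * (?B * const_poly_mat (P \<nu>)) $$ (i, i) = Polynomial.smult (P \<nu> $$ (i, i)) (char_poly A)"
      if "i < n" for i
      using arg_cong[OF adjugate_eq, of "\<lambda>D. D $$ (i, i)"] that B P[OF \<nu>] by simp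
    then show ?thesis
      by (simp add: sum_distrib_left smult_sum)
  qed
qed (fact assms)

section \<open>Spectral resolutions of graphs\<close>

lemma adj_mat_carrier [simp]: "adj_mat G \<in> carrier_mat (fst G) (fst G)"
  by (simp add: adj_mat_def)

lemma dim_adj_mat [simp]: "dim_row (adj_mat G) = fst G" "dim_col (adj_mat G) = fst G"
  by (simp_all add: adj_mat_def)

lemma transpose_adj_mat:
  assumes "is_graph G"
  shows "transpose_mat (adj_mat G) = adj_mat G"
  using assms by (intro eq_matI) (auto simp: adj_mat_def is_graph_def)

lemma char_poly_adj_mat_neq_0: "char_poly (adj_mat G) \<noteq> 0"
  using degree_monic_char_poly[OF adj_mat_carrier, of G] by auto

lemma eigenspace_carrier: "v \<in> eigenspace G \<mu> \<Longrightarrow> v \<in> carrier_vec (fst G)"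
  by (simp add: eigenspace_def)

lemma eigenspace_diff:
  assumes "v \<in> eigenspace G \<mu>" "w \<in> eigenspace G \<mu>"
  shows "v - w \<in> eigenspace G \<mu>"
  using assms mult_minus_distrib_mat_vec[OF adj_mat_carrier, of v G w]
  by (auto simp: eigenspace_def right_diff_distrib)

lemma eigenspaces_orthogonal:
  assumes "is_graph G" "v \<in> eigenspace G \<mu>" "w \<in> eigenspace G \<nu>" "\<mu> \<noteq> \<nu>"
  shows "v \<bullet> w = 0"
proof -
  have v: "v \<in> carrier_vec (fst G)" "adj_mat G *\<^sub>v v = \<mu> \<cdot>\<^sub>v v"
    and w: "w \<in> carrier_vec (fst G)" "adj_mat G *\<^sub>v w = \<nu> \<cdot>\<^sub>v w"
    using assms by (auto simp: eigenspace_def)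
  have "(transpose_mat (adj_mat G) *\<^sub>v v) \<bullet> w = v \<bullet> (adj_mat G *\<^sub>v w)"
    using v(1) w(1) by (intro transpose_vec_mult_scalar) auto
  then have "\<mu> * (v \<bullet> w) = \<nu> * (v \<bullet> w)"
    using v w by (simp add: transpose_adj_mat[OF assms(1)])
  then show ?thesis using assms(4) by simp
qed

lemma eigenspace_projection_unique:
  assumes v: "v \<in> carrier_vec (fst G)"
    and p: "p \<in> eigenspace G \<mu>" "\<And>w. w \<in> eigenspace G \<mu> \<Longrightarrow> (v - p) \<bullet> w = 0"
    and q: "q \<in> eigenspace G \<mu>" "\<And>w. w \<in> eigenspace G \<mu> \<Longrightarrow> (v - q) \<bullet> w = 0"
  shows "p = q"
proof -
  have d: "q - p \<in> eigenspace G \<mu>" by (rule eigenspace_diff[OF q(1) p(1)])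
  note carrier = v eigenspace_carrier[OF p(1)] eigenspace_carrier[OF q(1)]
  have "q - p = (v - p) - (v - q)"
    using carrier by (intro eq_vecI) auto
  then have "(q - p) \<bullet> (q - p) = ((v - p) - (v - q)) \<bullet> (q - p)" by simp
  also have "\<dots> = (v - p) \<bullet> (q - p) - (v - q) \<bullet> (q - p)"
    using carrier by (intro minus_scalar_prod_distrib[of _ "fst G"]) auto
  also have "\<dots> = 0" by (simp add: p(2) q(2) d)
  finally have "q - p = 0\<^sub>v (fst G)"
    using conjugate_square_eq_0_vec[OF eigenspace_carrier[OF d]] by simp
  then have "(q - p) $ i = 0" if "i < fst G" for i using that by simp
  then show ?thesis using carrier by (intro eq_vecI) auto
qed

lemma eq_mat_if_mult_vec_eq:
  fixes A B :: "'a :: semiring_1 mat"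
  assumes "A \<in> carrier_mat n m" "B \<in> carrier_mat n m"
    and "\<And>v. v \<in> carrier_vec m \<Longrightarrow> A *\<^sub>v v = B *\<^sub>v v"
  shows "A = B"
proof (rule eq_matI)
  fix i j assume "i < dim_row B" "j < dim_col B"
  then show "A $$ (i, j) = B $$ (i, j)"
    using assms(1,2) arg_cong[OF assms(3)[of "unit_vec m j"], of "\<lambda>v. v $ i"] by simp
qed (use assms(1,2) in auto)

lemma eig_proj_eqI:
  assumes carrier: "P \<in> carrier_mat (fst G) (fst G)"
    and P: "\<And>v. v \<in> carrier_vec (fst G) \<Longrightarrow> P *\<^sub>v v \<in> eigenspace G \<mu>"
    and orth: "\<And>v w. v \<in> carrier_vec (fst G) \<Longrightarrow> w \<in> eigenspace G \<mu> \<Longrightarrow> (v - P *\<^sub>v v) \<bullet> w = 0"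
  shows "eig_proj G \<mu> = P"
  unfolding eig_proj_def
proof (rule the_equality)
  fix Q assume Q: "Q \<in> carrier_mat (fst G) (fst G) \<and> (\<forall>v\<in>carrier_vec (fst G).
    Q *\<^sub>v v \<in> eigenspace G \<mu> \<and> (\<forall>w\<in>eigenspace G \<mu>. (v - Q *\<^sub>v v) \<bullet> w = 0))"
  then have "Q *\<^sub>v v = P *\<^sub>v v" if "v \<in> carrier_vec (fst G)" for v
    using that P orth by (blast intro: eigenspace_projection_unique[OF that])
  then show "Q = P"
    using Q carrier by (intro eq_mat_if_mult_vec_eq[of Q _ _ P]) auto
qed (use assms in blast)

locale spectral_resolution =
  fixes G :: graph and M :: "real set" and P :: "real \<Rightarrow> nat \<Rightarrow> nat \<Rightarrow> real"
  assumes graph: "is_graph G" and finite_eigs: "finite M"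
    and outside: "\<And>\<mu> x y. \<mu> \<notin> M \<Longrightarrow> x < fst G \<Longrightarrow> y < fst G \<Longrightarrow> P \<mu> x y = 0"
    and eigen: "\<And>\<mu> x y. x < fst G \<Longrightarrow> y < fst G \<Longrightarrow> (\<Sum>z\<in>nbrs G x. P \<mu> z y) = \<mu> * P \<mu> x y"
    and resolution: "\<And>x y. x < fst G \<Longrightarrow> y < fst G \<Longrightarrow> (\<Sum>\<mu>\<in>M. P \<mu> x y) = of_bool (x = y)"
begin

definition proj_mat :: "real \<Rightarrow> real mat" where
  "proj_mat \<mu> = mat (fst G) (fst G) (\<lambda>(x, y). P \<mu> x y)"

lemma proj_mat_carrier [simp]: "proj_mat \<mu> \<in> carrier_mat (fst G) (fst G)"
  by (simp add: proj_mat_def)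

lemma dim_proj_mat [simp]: "dim_row (proj_mat \<mu>) = fst G" "dim_col (proj_mat \<mu>) = fst G"
  by (simp_all add: proj_mat_def)

lemma proj_mat_nth [simp]: "x < fst G \<Longrightarrow> y < fst G \<Longrightarrow> proj_mat \<mu> $$ (x, y) = P \<mu> x y"
  by (simp add: proj_mat_def)

lemma adj_mat_mult_proj_mat: "adj_mat G * proj_mat \<mu> = \<mu> \<cdot>\<^sub>m proj_mat \<mu>"
proof (rule eq_matI)
  fix x y assume "x < dim_row (\<mu> \<cdot>\<^sub>m proj_mat \<mu>)" "y < dim_col (\<mu> \<cdot>\<^sub>m proj_mat \<mu>)"
  then have xy: "x < fst G" "y < fst G" by (simp_all add: proj_mat_def)
  then have "(adj_mat G * proj_mat \<mu>) $$ (x, y) = (\<Sum>z\<in>nbrs G x. P \<mu> z y)"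
    unfolding sum_nbrs by (auto simp: adj_mat_def proj_mat_def scalar_prod_def atLeast0LessThan intro: sum.cong)
  then show "(adj_mat G * proj_mat \<mu>) $$ (x, y) = (\<mu> \<cdot>\<^sub>m proj_mat \<mu>) $$ (x, y)"
    using xy by (simp add: eigen proj_mat_def)
qed (simp_all add: adj_mat_def proj_mat_def)

lemma proj_mat_mult_vec_in_eigenspace:
  assumes "v \<in> carrier_vec (fst G)"
  shows "proj_mat \<mu> *\<^sub>v v \<in> eigenspace G \<mu>"
proof -
  have "adj_mat G *\<^sub>v (proj_mat \<mu> *\<^sub>v v) = (adj_mat G * proj_mat \<mu>) *\<^sub>v v"
    using assms by (simp add: assoc_mult_mat_vec[of _ "fst G" "fst G" _ "fst G"])
  also have "\<dots> = \<mu> \<cdot>\<^sub>v (proj_mat \<mu> *\<^sub>v v)"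
    unfolding adj_mat_mult_proj_mat using assms by (intro eq_vecI) auto
  finally show ?thesis
    using mult_mat_vec_carrier[OF proj_mat_carrier assms] by (simp add: eigenspace_def)
qed

lemma scalar_prod_resolution:
  assumes "v \<in> carrier_vec (fst G)" "w \<in> carrier_vec (fst G)"
  shows "v \<bullet> w = (\<Sum>\<mu>\<in>M. (proj_mat \<mu> *\<^sub>v v) \<bullet> w)"
proof -
  have "(\<Sum>\<mu>\<in>M. (proj_mat \<mu> *\<^sub>v v) $ x) = v $ x" if x: "x < fst G" for x
  proof -
    have "(\<Sum>\<mu>\<in>M. (proj_mat \<mu> *\<^sub>v v) $ x) = (\<Sum>y<fst G. (\<Sum>\<mu>\<in>M. P \<mu> x y) * v $ y)"
      using assms(1) x
      by (simp add: proj_mat_def scalar_prod_def atLeast0LessThan sum.swap[of _ _ M] sum_distrib_right)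
    also have "\<dots> = v $ x"
      using x by (simp add: resolution of_bool_def if_distribR if_distrib[of "\<lambda>a. a * _"] cong: if_cong)
    finally show ?thesis .
  qed
  then have "v \<bullet> w = (\<Sum>x<fst G. \<Sum>\<mu>\<in>M. (proj_mat \<mu> *\<^sub>v v) $ x * w $ x)"
    using assms(2) by (simp add: scalar_prod_def atLeast0LessThan flip: sum_distrib_right)
  also have "\<dots> = (\<Sum>\<mu>\<in>M. (proj_mat \<mu> *\<^sub>v v) \<bullet> w)"
    using assms(2) by (subst sum.swap) (simp add: scalar_prod_def atLeast0LessThan)
  finally show ?thesis .
qed

lemma scalar_prod_eigenvector:
  assumes "v \<in> carrier_vec (fst G)" "w \<in> eigenspace G \<mu>"
  shows "v \<bullet> w = (proj_mat \<mu> *\<^sub>v v) \<bullet> w"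
proof -
  have other: "(proj_mat \<nu> *\<^sub>v v) \<bullet> w = 0" if "\<nu> \<noteq> \<mu>" for \<nu>
    using eigenspaces_orthogonal[OF graph proj_mat_mult_vec_in_eigenspace[OF assms(1)] assms(2) that] .
  have trivial: "(proj_mat \<mu> *\<^sub>v v) \<bullet> w = 0" if "\<mu> \<notin> M"
    using that assms eigenspace_carrier[OF assms(2)]
    by (auto simp: proj_mat_def scalar_prod_def outside intro!: sum.neutral)
  have "(\<Sum>\<nu>\<in>M. (proj_mat \<nu> *\<^sub>v v) \<bullet> w) = (\<Sum>\<nu>\<in>M. if \<nu> = \<mu> then (proj_mat \<mu> *\<^sub>v v) \<bullet> w else 0)"
    by (intro sum.cong) (auto simp: other)
  then show ?thesis
    using trivial scalar_prod_resolution[OF assms(1) eigenspace_carrier[OF assms(2)]]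
    by (simp add: finite_eigs split: if_splits)
qed

lemma eig_proj_eq_proj_mat: "eig_proj G \<mu> = proj_mat \<mu>"
proof (rule eig_proj_eqI)
  fix v w :: "real vec" assume v: "v \<in> carrier_vec (fst G)" and w: "w \<in> eigenspace G \<mu>"
  then show "(v - proj_mat \<mu> *\<^sub>v v) \<bullet> w = 0"
    using minus_scalar_prod_distrib[OF v mult_mat_vec_carrier[OF proj_mat_carrier v] eigenspace_carrier[OF w]]
    by (simp add: scalar_prod_eigenvector)
qed (simp_all add: proj_mat_mult_vec_in_eigenspace)

lemma count_Spec: "real (count (Spec G) \<mu>) = (\<Sum>x<fst G. P \<mu> x x)"
proof -
  have "real (count (Spec G) \<mu>) = (if \<mu> \<in> M then \<Sum>x<fst G. proj_mat \<mu> $$ (x, x) else 0)"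
    using order_char_poly_eq_trace[OF adj_mat_carrier finite_eigs proj_mat_carrier adj_mat_mult_proj_mat, of \<mu>]
    by (simp add: Spec_def char_poly_adj_mat_neq_0 resolution)
  then show ?thesis by (simp add: outside)
qed

lemma mem_Spec_if_nonzero:
  assumes "P \<mu> x y \<noteq> 0" "x < fst G" "y < fst G"
  shows "\<mu> \<in># Spec G"
proof -
  have "col (proj_mat \<mu>) y $ x \<noteq> 0"
    using assms by (simp add: proj_mat_def)
  then have "col (proj_mat \<mu>) y \<noteq> 0\<^sub>v (fst G)"
    using assms(2) by (metis index_zero_vec(1))
  moreover have "adj_mat G *\<^sub>v col (proj_mat \<mu>) y = \<mu> \<cdot>\<^sub>v col (proj_mat \<mu>) y"
    unfolding col_mult2[OF adj_mat_carrier proj_mat_carrier assms(3), symmetric] adj_mat_mult_proj_mat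
    using assms(3) by simp
  moreover have "col (proj_mat \<mu>) y \<in> carrier_vec (dim_row (adj_mat G))"
    using col_dim[of "proj_mat \<mu>" y] by simp
  ultimately have "eigenvalue (adj_mat G) \<mu>"
    unfolding eigenvalue_def eigenvector_def by auto
  then show ?thesis
    by (simp add: Spec_def char_poly_adj_mat_neq_0 eigenvalue_root_char_poly[OF adj_mat_carrier])
qed

lemma Pstar_eq_iff:
  assumes "spectral_resolution H N Q" "Spec G = Spec H"
    and "x < fst G" "y < fst G" "x' < fst H" "y' < fst H"
  shows "Pstar G x y = Pstar H x' y' \<longleftrightarrow> (\<forall>\<mu>. P \<mu> x y = Q \<mu> x' y')"
proof -
  interpret H: spectral_resolution H N Q by fact
  have "P \<mu> x y = 0 \<and> Q \<mu> x' y' = 0" if "\<mu> \<notin># Spec G" for \<mu>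
    using that mem_Spec_if_nonzero H.mem_Spec_if_nonzero assms by metis
  moreover have "Pstar G x y = Pstar H x' y' \<longleftrightarrow> (\<forall>\<mu>\<in>#Spec G. P \<mu> x y = Q \<mu> x' y')"
    using assms by (simp add: Pstar_def distinct_eigs_def eig_proj_eq_proj_mat H.eig_proj_eq_proj_mat)
  ultimately show ?thesis by metis
qed

end

lemma spectral_resolution_iso:
  assumes "graph_iso h G H" "is_graph G" "spectral_resolution H M P"
  shows "spectral_resolution G M (\<lambda>\<mu> x y. P \<mu> (h x) (h y))"
proof -
  interpret H: spectral_resolution H M P by fact
  have h: "bij_betw h (verts G) (verts H)" "\<And>x. x < fst G \<Longrightarrow> h x < fst H"
    using assms(1) graph_iso_verts(2) by (auto simp: graph_iso_def)
  show ?thesis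
  proof
    fix \<mu> x y assume xy: "x < fst G" "y < fst G"
    show "(\<Sum>z\<in>nbrs G x. P \<mu> (h z) (h y)) = \<mu> * P \<mu> (h x) (h y)"
      using sum.reindex_bij_betw[OF graph_iso_nbrs[OF assms(1) xy(1)], of "\<lambda>z. P \<mu> z (h y)"]
        H.eigen h(2) xy by simp
    show "(\<Sum>\<mu>\<in>M. P \<mu> (h x) (h y)) = of_bool (x = y)"
      using xy h bij_betw_imp_inj_on[OF h(1)] by (simp add: H.resolution inj_on_eq_iff)
  qed (simp_all add: assms(2) H.finite_eigs H.outside h(2))
qed

lemma Spec_eq_if_trace_eq:
  assumes "spectral_resolution G M P" "spectral_resolution H N Q"
    and "\<And>\<mu>. (\<Sum>x<fst G. P \<mu> x x) = (\<Sum>x<fst H. Q \<mu> x x)"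
  shows "Spec G = Spec H"
proof (rule multiset_eqI)
  fix \<mu>
  have "real (count (Spec G) \<mu>) = real (count (Spec H) \<mu>)"
    using assms by (simp only: spectral_resolution.count_Spec)
  then show "count (Spec G) \<mu> = count (Spec H) \<mu>" by simp
qed

lemma Pstar_iso:
  assumes "graph_iso h G H" "is_graph G" "spectral_resolution H M P" "x < fst G" "y < fst G"
  shows "Pstar G x y = Pstar H (h x) (h y)"
proof -
  note G = spectral_resolution_iso[OF assms(1-3)]
  have "(\<Sum>x<fst G. P \<mu> (h x) (h x)) = (\<Sum>x<fst H. P \<mu> x x)" for \<mu>
    using assms(1) sum.reindex_bij_betw[of h "verts G" "verts H" "\<lambda>x. P \<mu> x x"]
    by (simp add: graph_iso_def verts_def atLeast0LessThan)
  then have "Spec G = Spec H"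
    by (rule Spec_eq_if_trace_eq[OF G assms(3)])
  then show ?thesis
    using spectral_resolution.Pstar_eq_iff[OF G assms(3)] assms(4,5) graph_iso_verts(2)[OF assms(1)]
    by simp
qed

section \<open>Compositions of graphs\<close>

lemma div_mod_less_if_less_mult:
  fixes x k m :: nat
  assumes "x < k * m"
  shows "x div m < k" "x mod m < m"
  using assms by (cases "m = 0"; simp add: less_mult_imp_div_less)+

lemma mult_add_less_mult:
  fixes u i k m :: nat
  assumes "u < k" "i < m"
  shows "u * m + i < k * m"
proof -
  have "u * m + i < Suc u * m" using assms(2) by simp
  also have "\<dots> \<le> k * m" using assms(1) by (intro mult_le_mono1) simp
  finally show ?thesis .
qed

lemma sum_lessThan_mult:
  "(\<Sum>x<k * m. f x) = (\<Sum>u<k. \<Sum>i<m. f (u * m + i))" for f :: "nat \<Rightarrow> 'a :: comm_monoid_add"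
  by (simp add: sum.nat_group[symmetric] sum.atLeastLessThan_shift_0[of f] mult.commute[of m]
      atLeast0LessThan comp_def)

lemma image_mset_mset_set_eq_sum: "image_mset f (mset_set A) = (\<Sum>a\<in>A. {#f a#})"
  by (induction A rule: infinite_finite_induct) auto

text \<open>Schwenk's generalized composition, with vertex \<open>i\<close> of the fibre \<open>F u\<close> encoded as \<open>u * m + i\<close>.\<close>

definition composition :: "graph \<Rightarrow> nat \<Rightarrow> (nat \<Rightarrow> graph) \<Rightarrow> graph" where
  "composition B m F = (fst B * m, \<lambda>x y.
     if x div m = y div m then snd (F (x div m)) (x mod m) (y mod m) else snd B (x div m) (y div m))"

lemma fst_composition [simp]: "fst (composition B m F) = fst B * m"
  by (simp add: composition_def)

definition regular_fibres :: "graph \<Rightarrow> nat \<Rightarrow> nat \<Rightarrow> (nat \<Rightarrow> graph) \<Rightarrow> bool" where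
  "regular_fibres B m d F \<longleftrightarrow> (\<forall>u<fst B. fst (F u) = m \<and> is_regular d (F u))"

lemma regular_fibresD:
  assumes "regular_fibres B m d F" "u < fst B"
  shows "fst (F u) = m" "is_regular d (F u)" "is_graph (F u)"
  using assms by (auto simp: regular_fibres_def is_regular_def)

lemma is_graph_composition:
  assumes "is_graph B" "regular_fibres B m d F"
  shows "is_graph (composition B m F)"
proof -
  have "snd (composition B m F) x y = snd (composition B m F) y x \<and> \<not> snd (composition B m F) x x"
    if "x < fst B * m" "y < fst B * m" for x y
    using that[THEN div_mod_less_if_less_mult(1)] that[THEN div_mod_less_if_less_mult(2)]
      assms(1) regular_fibresD(1,3)[OF assms(2)]
    by (simp add: composition_def is_graph_def)
  then show ?thesis by (simp add: is_graph_def)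
qed

lemma sum_nbrs_composition:
  fixes f :: "nat \<Rightarrow> 'a :: comm_monoid_add"
  assumes "is_graph B" "regular_fibres B m d F" "x < fst B * m"
  defines "u \<equiv> x div m"
  shows "(\<Sum>y\<in>nbrs (composition B m F) x. f y) =
    (\<Sum>j\<in>nbrs (F u) (x mod m). f (u * m + j)) + (\<Sum>w\<in>nbrs B u. \<Sum>j<m. f (w * m + j))"
proof -
  have u: "u < fst B" using assms(3) by (simp add: u_def div_mod_less_if_less_mult)
  then have irrefl: "\<not> snd B u u" using assms(1) by (simp add: is_graph_def)
  have "(\<Sum>y\<in>nbrs (composition B m F) x. f y) =
      (\<Sum>w<fst B. \<Sum>j<m. if snd (composition B m F) x (w * m + j) then f (w * m + j) else 0)"
    by (simp add: sum_nbrs sum_lessThan_mult)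
  also have "\<dots> = (\<Sum>w<fst B. (if w = u then \<Sum>j\<in>nbrs (F u) (x mod m). f (u * m + j) else 0) +
      (if snd B u w then \<Sum>j<m. f (w * m + j) else 0))"
  proof (rule sum.cong)
    fix w assume "w \<in> {..<fst B}"
    have "snd (composition B m F) x (w * m + j) \<longleftrightarrow>
        (if w = u then snd (F u) (x mod m) j else snd B u w)" if "j < m" for j
      using that by (auto simp: composition_def u_def)
    then show "(\<Sum>j<m. if snd (composition B m F) x (w * m + j) then f (w * m + j) else 0) =
        (if w = u then \<Sum>j\<in>nbrs (F u) (x mod m). f (u * m + j) else 0) +
        (if snd B u w then \<Sum>j<m. f (w * m + j) else 0)"
      using irrefl regular_fibresD(1)[OF assms(2) u] by (auto simp: sum_nbrs intro: sum.cong)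
  qed simp
  also have "\<dots> = (\<Sum>j\<in>nbrs (F u) (x mod m). f (u * m + j)) + (\<Sum>w\<in>nbrs B u. \<Sum>j<m. f (w * m + j))"
    using u by (simp add: sum.distrib sum_nbrs)
  finally show ?thesis .
qed

text \<open>Individualizing \<open>x\<close> separates the vertices of the fibre of \<open>x\<close>, but the coloring that is constant on
  every other fibre is already equitable, and its parameters depend on the degree of these fibres only.\<close>

definition collapse_fibres_except :: "nat \<Rightarrow> nat \<Rightarrow> nat \<Rightarrow> nat" where
  "collapse_fibres_except m u y = (if y div m = u then y else y div m * m)"

lemma collapse_fibres_except_eqD:
  assumes "collapse_fibres_except m u y = collapse_fibres_except m u z"
  shows "y div m = z div m" "y div m = u \<Longrightarrow> y = z"
proof -
  have "collapse_fibres_except m u a div m = a div m" for a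
    by (simp add: collapse_fibres_except_def)
  with assms show "y div m = z div m" by metis
  with assms show "y div m = u \<Longrightarrow> y = z" by (simp add: collapse_fibres_except_def)
qed

lemma collapse_nbrs_in_fibre:
  assumes "regular_fibres B m d F" "v < fst B" "i < m" "v \<noteq> u"
  shows "(\<Sum>j\<in>nbrs (F v) i. {#collapse_fibres_except m u (v * m + j)#}) = replicate_mset d (v * m)"
proof -
  note F = regular_fibresD(1,2)[OF assms(1,2)]
  have "(\<Sum>j\<in>nbrs (F v) i. {#collapse_fibres_except m u (v * m + j)#}) = (\<Sum>j\<in>nbrs (F v) i. {#v * m#})"
    using assms(4) by (intro sum.cong) (auto simp: collapse_fibres_except_def F(1))
  also have "\<dots> = replicate_mset d (v * m)"
    using F assms(3) by (simp add: is_regular_def image_mset_const_eq flip: image_mset_mset_set_eq_sum)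
  finally show ?thesis .
qed

lemma jointly_equitable_composition:
  assumes B: "is_graph B" and F: "regular_fibres B m d F" and F': "regular_fibres B m d F'"
    and fibre: "F u = F' u"
  shows "jointly_equitable (composition B m F) (collapse_fibres_except m u)
    (composition B m F') (collapse_fibres_except m u)"
  unfolding jointly_equitable_def image_mset_mset_set_eq_sum
proof (intro ballI impI)
  let ?p = "collapse_fibres_except m u"
  fix y z assume "y \<in> verts (composition B m F)" "z \<in> verts (composition B m F')" and eq: "?p y = ?p z"
  then have y: "y < fst B * m" and z: "z < fst B * m" by simp_all
  note div_eq = collapse_fibres_except_eqD(1)[OF eq]
  have "(\<Sum>j\<in>nbrs (F (y div m)) (y mod m). {#?p (y div m * m + j)#}) =
      (\<Sum>j\<in>nbrs (F' (z div m)) (z mod m). {#?p (z div m * m + j)#})"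
  proof (cases "y div m = u")
    case True
    then have "y = z" by (rule collapse_fibres_except_eqD(2)[OF eq])
    with True show ?thesis by (simp add: fibre)
  next
    case False
    then have "z div m \<noteq> u" by (simp add: div_eq)
    from collapse_nbrs_in_fibre[OF F' div_mod_less_if_less_mult[OF z] this] show ?thesis
      using collapse_nbrs_in_fibre[OF F div_mod_less_if_less_mult[OF y] False] div_eq by simp
  qed
  then show "(\<Sum>a\<in>nbrs (composition B m F) y. {#?p a#}) = (\<Sum>a\<in>nbrs (composition B m F') z. {#?p a#})"
    by (simp only: sum_nbrs_composition[OF B F y] sum_nbrs_composition[OF B F' z] div_eq)
qed

lemma WL1_composition_eq_if_fibre_eq:
  assumes "is_graph B" "regular_fibres B m d F" "regular_fibres B m d F'" "F (x div m) = F' (x div m)"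
  shows "WL1 (composition B m F) (indiv x) = WL1 (composition B m F') (indiv x)"
proof (rule WL1_eq_if_jointly_equitable[OF jointly_equitable_composition[OF assms]])
  fix y z assume "collapse_fibres_except m (x div m) y = collapse_fibres_except m (x div m) z"
  from collapse_fibres_except_eqD[OF this] show "indiv x y = indiv x z"
    by (auto simp: indiv_def)
qed (simp_all add: verts_def)

definition permute_fibres :: "nat \<Rightarrow> (nat \<Rightarrow> nat) \<Rightarrow> nat \<Rightarrow> nat" where
  "permute_fibres m \<sigma> x = \<sigma> (x div m) * m + x mod m"

lemma permute_fibres_div_mod:
  assumes "x < k * m"
  shows "permute_fibres m \<sigma> x div m = \<sigma> (x div m)" "permute_fibres m \<sigma> x mod m = x mod m"
  using div_mod_less_if_less_mult(2)[OF assms] by (simp_all add: permute_fibres_def)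

lemma bij_betw_permute_fibres:
  assumes "bij_betw \<sigma> {..<k} {..<k}"
  shows "bij_betw (permute_fibres m \<sigma>) {..<k * m} {..<k * m}"
proof (rule bij_betw_byWitness[where f' = "permute_fibres m (inv_into {..<k} \<sigma>)"])
  note inverse = bij_betw_inv_into[OF assms] bij_betw_inv_into_left[OF assms] bij_betw_inv_into_right[OF assms]
  have less: "permute_fibres m \<rho> x < k * m" if "bij_betw \<rho> {..<k} {..<k}" "x < k * m" for \<rho> x
    using div_mod_less_if_less_mult[OF that(2)] bij_betwE[OF that(1)]
    by (simp add: permute_fibres_def mult_add_less_mult)
  then show "permute_fibres m \<sigma> ` {..<k * m} \<subseteq> {..<k * m}"
      "permute_fibres m (inv_into {..<k} \<sigma>) ` {..<k * m} \<subseteq> {..<k * m}"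
    using assms inverse(1) by auto
  show "\<forall>x\<in>{..<k * m}. permute_fibres m (inv_into {..<k} \<sigma>) (permute_fibres m \<sigma> x) = x"
       "\<forall>x\<in>{..<k * m}. permute_fibres m \<sigma> (permute_fibres m (inv_into {..<k} \<sigma>) x) = x"
    using inverse(2,3) div_mod_less_if_less_mult
    by (auto simp: permute_fibres_div_mod permute_fibres_def[of _ _ "permute_fibres _ _ _"])
qed

lemma graph_iso_permute_fibres:
  assumes "graph_iso \<sigma> B B"
  shows "graph_iso (permute_fibres m \<sigma>) (composition B m (F \<circ> \<sigma>)) (composition B m F)"
proof -
  have \<sigma>: "bij_betw \<sigma> {..<fst B} {..<fst B}"
    and adj: "\<And>u v. u < fst B \<Longrightarrow> v < fst B \<Longrightarrow> snd B (\<sigma> u) (\<sigma> v) \<longleftrightarrow> snd B u v"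
    using assms by (simp_all add: graph_iso_def verts_def atLeast0LessThan)
  have "snd (composition B m (F \<circ> \<sigma>)) x y \<longleftrightarrow>
      snd (composition B m F) (permute_fibres m \<sigma> x) (permute_fibres m \<sigma> y)"
    if "x < fst B * m" "y < fst B * m" for x y
    using that bij_betw_imp_inj_on[OF \<sigma>] div_mod_less_if_less_mult(1)
    by (simp add: composition_def permute_fibres_div_mod inj_on_eq_iff adj)
  then show ?thesis
    using bij_betw_permute_fibres[OF \<sigma>] by (simp add: graph_iso_def verts_def atLeast0LessThan)
qed

lemma regular_fibres_permute:
  assumes "regular_fibres B m d F" "bij_betw \<pi> (verts B) (verts B)"
  shows "regular_fibres B m d (F \<circ> \<pi>)"
  using assms(1) bij_betwE[OF assms(2)] by (simp add: regular_fibres_def)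

text \<open>A rooted invariant that sees only the fibre of the root does not distinguish between a permutation of
  the fibres and an automorphism of \<open>B\<close> that moves the fibre of the root to the same place.\<close>

lemma image_mset_composition_permute:
  fixes f :: "graph \<Rightarrow> nat \<Rightarrow> 'a"
  assumes "vertex_transitive B" and \<pi>: "bij_betw \<pi> (verts B) (verts B)"
    and fibre_local: "\<And>\<rho> \<sigma> x. bij_betw \<rho> (verts B) (verts B) \<Longrightarrow> bij_betw \<sigma> (verts B) (verts B) \<Longrightarrow>
      x < fst B * m \<Longrightarrow> \<rho> (x div m) = \<sigma> (x div m) \<Longrightarrow>
      f (composition B m (F \<circ> \<rho>)) x = f (composition B m (F \<circ> \<sigma>)) x"
    and iso: "\<And>h \<sigma> x. bij_betw \<sigma> (verts B) (verts B) \<Longrightarrow>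
      graph_iso h (composition B m (F \<circ> \<sigma>)) (composition B m F) \<Longrightarrow> x < fst B * m \<Longrightarrow>
      f (composition B m (F \<circ> \<sigma>)) x = f (composition B m F) (h x)"
  shows "image_mset (f (composition B m (F \<circ> \<pi>))) (mset_set (verts (composition B m (F \<circ> \<pi>)))) =
    image_mset (f (composition B m F)) (mset_set (verts (composition B m F)))"
proof -
  have "f (composition B m (F \<circ> \<pi>)) x = f (composition B m F) (permute_fibres m \<pi> x)"
    if x: "x < fst B * m" for x
  proof -
    have "x div m < fst B" by (rule div_mod_less_if_less_mult[OF x])
    moreover from this have "\<pi> (x div m) < fst B" using bij_betwE[OF \<pi>] by simp
    ultimately obtain \<sigma> where \<sigma>: "graph_iso \<sigma> B B" "\<sigma> (x div m) = \<pi> (x div m)"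
      using assms(1) unfolding vertex_transitive_def by (meson mem_verts)
    then have bij: "bij_betw \<sigma> (verts B) (verts B)" by (simp add: graph_iso_def)
    have "f (composition B m (F \<circ> \<pi>)) x = f (composition B m (F \<circ> \<sigma>)) x"
      using \<sigma>(2) by (intro fibre_local \<pi> bij x) simp
    also have "\<dots> = f (composition B m F) (permute_fibres m \<sigma> x)"
      by (intro iso bij graph_iso_permute_fibres \<sigma>(1) x)
    finally show ?thesis by (simp add: permute_fibres_def \<sigma>(2))
  qed
  then have "image_mset (f (composition B m (F \<circ> \<pi>))) (mset_set {..<fst B * m}) =
      image_mset (f (composition B m F)) (image_mset (permute_fibres m \<pi>) (mset_set {..<fst B * m}))"
    unfolding multiset.map_comp by (intro image_mset_cong) simp
  also have "image_mset (permute_fibres m \<pi>) (mset_set {..<fst B * m}) = mset_set {..<fst B * m}"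
    using \<pi> by (intro mset_set_bij_betw[symmetric] bij_betw_permute_fibres) (simp add: verts_def atLeast0LessThan)
  finally show ?thesis unfolding verts_def fst_composition atLeast0LessThan .
qed

theorem WL32_composition_permute:
  assumes "is_graph B" "vertex_transitive B" "regular_fibres B m d F" "bij_betw \<pi> (verts B) (verts B)"
  shows "WL32 (composition B m (F \<circ> \<pi>)) = WL32 (composition B m F)"
  unfolding WL32_def
proof (rule image_mset_composition_permute[OF assms(2,4)])
  fix \<rho> \<sigma> x
  assume "bij_betw \<rho> (verts B) (verts B)" "bij_betw \<sigma> (verts B) (verts B)" "\<rho> (x div m) = \<sigma> (x div m)"
  then show "WL1 (composition B m (F \<circ> \<rho>)) (indiv x) = WL1 (composition B m (F \<circ> \<sigma>)) (indiv x)"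
    by (intro WL1_composition_eq_if_fibre_eq[OF assms(1), where d = d] regular_fibres_permute[OF assms(3)]) simp_all
qed (simp add: WL1_indiv_iso)

section \<open>Spectral resolutions of compositions\<close>

lemma (in spectral_resolution) sum_column_regular:
  assumes "is_regular d G" "y < fst G"
  shows "(\<Sum>x<fst G. P \<mu> x y) = of_bool (\<mu> = real d)"
proof -
  define S where "S \<mu> = (\<Sum>x<fst G. P \<mu> x y)" for \<mu>
  have S_eigen: "\<mu> * S \<mu> = d * S \<mu>" for \<mu>
  proof -
    have "\<mu> * S \<mu> = (\<Sum>x<fst G. \<Sum>z | z \<in> {..<fst G} \<and> snd G x z. P \<mu> z y)"
      using assms(2) by (simp add: S_def sum_distrib_left nbrs_def verts_def flip: eigen)
    also have "\<dots> = (\<Sum>z<fst G. \<Sum>x | x \<in> {..<fst G} \<and> snd G x z. P \<mu> z y)"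
      by (rule sum.swap_restrict) simp_all
    also have "\<dots> = (\<Sum>z<fst G. card (nbrs G z) * P \<mu> z y)"
    proof (rule sum.cong)
      fix z assume "z \<in> {..<fst G}"
      then have "{x. x \<in> {..<fst G} \<and> snd G x z} = nbrs G z"
        using graph by (auto simp: is_graph_def)
      then show "(\<Sum>x | x \<in> {..<fst G} \<and> snd G x z. P \<mu> z y) = card (nbrs G z) * P \<mu> z y" by simp
    qed simp
    also have "\<dots> = d * S \<mu>"
      using assms(1) by (simp add: is_regular_def S_def sum_distrib_left)
    finally show ?thesis .
  qed
  then have "(\<Sum>\<mu>\<in>M. S \<mu>) = (\<Sum>\<mu>\<in>M. if \<mu> = d then S d else 0)"
    by (intro sum.cong) auto
  moreover have "(\<Sum>\<mu>\<in>M. S \<mu>) = 1"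
    using assms(2) by (simp add: S_def sum.swap[of _ _ M] resolution)
  ultimately have "S d = 1"
    using finite_eigs by (simp split: if_splits)
  then show ?thesis
    using S_eigen[of \<mu>] by (auto simp: S_def)
qed

lemma (in spectral_resolution) resolution_superset:
  assumes "finite N" "M \<subseteq> N" "x < fst G" "y < fst G"
  shows "(\<Sum>\<mu>\<in>N. P \<mu> x y) = of_bool (x = y)"
proof -
  have "(\<Sum>\<mu>\<in>N. P \<mu> x y) = (\<Sum>\<mu>\<in>M. P \<mu> x y)"
    using assms outside by (intro sum.mono_neutral_right) auto
  then show ?thesis using assms by (simp add: resolution)
qed

text \<open>On vectors with zero sum on every fibre, the composition acts like the disjoint union of the fibres;
  on vectors that are constant on the fibres, it acts like \<open>d + m A\<close> where \<open>A\<close> is the adjacency matrix of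
  \<open>B\<close>.\<close>

definition composition_proj ::
    "nat \<Rightarrow> nat \<Rightarrow> (real \<Rightarrow> nat \<Rightarrow> nat \<Rightarrow> real) \<Rightarrow> (nat \<Rightarrow> real \<Rightarrow> nat \<Rightarrow> nat \<Rightarrow> real) \<Rightarrow>
     real \<Rightarrow> nat \<Rightarrow> nat \<Rightarrow> real" where
  "composition_proj m d P Q \<mu> x y =
     (if x div m = y div m then Q (x div m) \<mu> (x mod m) (y mod m) - of_bool (\<mu> = d) / m else 0) +
     P ((\<mu> - d) / m) (x div m) (y div m) / m"

locale composition_resolution =
  base: spectral_resolution B M P
  for B :: graph and M P +
  fixes m d :: nat and F :: "nat \<Rightarrow> graph" and N Q
  assumes fibres: "regular_fibres B m d F"
    and fibre_resolution: "\<And>u. u < fst B \<Longrightarrow> spectral_resolution (F u) (N u) (Q u)"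
begin

definition composition_eigs :: "real set" where
  "composition_eigs = insert (real d) ((\<lambda>\<theta>. d + m * \<theta>) ` M \<union> (\<Union>u<fst B. N u))"

lemma finite_composition_eigs: "finite composition_eigs"
  using base.finite_eigs spectral_resolution.finite_eigs[OF fibre_resolution]
  by (simp add: composition_eigs_def)

lemma composition_proj_outside:
  assumes "\<mu> \<notin> composition_eigs" "x < fst B * m" "y < fst B * m"
  shows "composition_proj m d P Q \<mu> x y = 0"
proof -
  note xy = div_mod_less_if_less_mult[OF assms(2)] div_mod_less_if_less_mult[OF assms(3)]
  have "(\<mu> - d) / m \<notin> M"
  proof
    assume "(\<mu> - d) / m \<in> M"
    moreover have "\<mu> = d + m * ((\<mu> - d) / m)" using xy by simp
    ultimately show False using assms(1) unfolding composition_eigs_def by blast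
  qed
  then have "P ((\<mu> - d) / m) (x div m) (y div m) = 0"
    by (rule base.outside) (use xy in auto)
  moreover have "Q (x div m) \<mu> (x mod m) (y mod m) = 0"
    using assms(1) xy regular_fibresD(1)[OF fibres]
    by (intro spectral_resolution.outside[OF fibre_resolution]) (auto simp: composition_eigs_def)
  ultimately show ?thesis
    using assms(1) by (auto simp: composition_proj_def composition_eigs_def)
qed

lemma composition_proj_eigen:
  assumes x: "x < fst B * m" and y: "y < fst B * m"
  shows "(\<Sum>z\<in>nbrs (composition B m F) x. composition_proj m d P Q \<mu> z y) =
    \<mu> * composition_proj m d P Q \<mu> x y"
proof -
  define u i v j \<theta> where "u = x div m" and "i = x mod m" and "v = y div m" and "j = y mod m"
    and "\<theta> = (\<mu> - d) / m"
  have less: "u < fst B" "i < m" "v < fst B" "j < m"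
    using div_mod_less_if_less_mult[OF x] div_mod_less_if_less_mult[OF y] by (simp_all add: u_def i_def v_def j_def)
  interpret fibre: spectral_resolution "F v" "N v" "Q v"
    by (rule fibre_resolution[OF less(3)])
  have F: "fst (F w) = m" "is_regular d (F w)" if "w < fst B" for w
    using regular_fibresD[OF fibres that] by simp_all
  define q where "q l = Q v \<mu> l j - of_bool (\<mu> = d) / m" for l
  have proj: "composition_proj m d P Q \<mu> (w * m + l) y = (if w = v then q l else 0) + P \<theta> w v / m"
    if "l < m" for w l
    using that by (simp add: composition_proj_def q_def v_def j_def \<theta>_def)
  have sum_q: "(\<Sum>l<m. q l) = 0"
    using fibre.sum_column_regular[of d j \<mu>] F[OF less(3)] less by (simp add: q_def sum_subtractf)
  then have sum_if_q: "(\<Sum>l<m. if w = v then q l else 0) = 0" for w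
    by (cases "w = v") simp_all
  have sum_q_nbrs: "(\<Sum>l\<in>nbrs (F v) i. q l) = \<mu> * q i"
    using fibre.eigen[of i j \<mu>] F[OF less(3)] less
    by (auto simp: q_def sum_subtractf is_regular_def right_diff_distrib)
  have "(\<Sum>z\<in>nbrs (composition B m F) x. composition_proj m d P Q \<mu> z y) =
      (\<Sum>l\<in>nbrs (F u) i. (if u = v then q l else 0) + P \<theta> u v / m) +
      (\<Sum>w\<in>nbrs B u. \<Sum>l<m. (if w = v then q l else 0) + P \<theta> w v / m)"
    unfolding sum_nbrs_composition[OF base.graph fibres x] u_def[symmetric] i_def[symmetric]
    using F(1)[OF less(1)] by (intro arg_cong2[of _ _ _ _ "(+)"] sum.cong) (auto simp: proj)
  also have "\<dots> = (if u = v then \<mu> * q i else 0) + d * (P \<theta> u v / m) + (\<Sum>w\<in>nbrs B u. P \<theta> w v)"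
    using sum_q_nbrs F[OF less(1)] less by (auto simp: sum.distrib sum_if_q is_regular_def)
  also have "\<dots> = \<mu> * ((if u = v then q i else 0) + P \<theta> u v / m)"
    using less by (simp add: base.eigen \<theta>_def field_simps)
  also have "(if u = v then q i else 0) + P \<theta> u v / m = composition_proj m d P Q \<mu> x y"
    using proj[of i u] less by (simp add: u_def i_def)
  finally show ?thesis .
qed

lemma sum_base_proj:
  assumes "0 < m" "u < fst B" "v < fst B"
  shows "(\<Sum>\<mu>\<in>composition_eigs. P ((\<mu> - d) / m) u v) = of_bool (u = v)"
proof -
  let ?\<theta> = "\<lambda>\<mu>. (\<mu> - real d) / m"
  have "(\<Sum>\<mu>\<in>composition_eigs. P (?\<theta> \<mu>) u v) = (\<Sum>\<theta>\<in>?\<theta> ` composition_eigs. P \<theta> u v)"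
    using assms(1) by (subst sum.reindex) (auto simp: inj_on_def)
  also have "\<dots> = of_bool (u = v)"
  proof (rule base.resolution_superset)
    show "M \<subseteq> ?\<theta> ` composition_eigs"
    proof
      fix \<theta> assume "\<theta> \<in> M"
      moreover have "\<theta> = ?\<theta> (d + m * \<theta>)" using assms(1) by simp
      ultimately show "\<theta> \<in> ?\<theta> ` composition_eigs"
        unfolding composition_eigs_def by blast
    qed
  qed (use finite_composition_eigs assms in auto)
  finally show ?thesis .
qed

lemma composition_proj_resolution:
  assumes x: "x < fst B * m" and y: "y < fst B * m"
  shows "(\<Sum>\<mu>\<in>composition_eigs. composition_proj m d P Q \<mu> x y) = of_bool (x = y)"
proof -
  define u v where "u = x div m" and "v = y div m"
  have less: "u < fst B" "v < fst B" "x mod m < m" "y mod m < m"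
    using div_mod_less_if_less_mult[OF x] div_mod_less_if_less_mult[OF y] by (simp_all add: u_def v_def)
  interpret fibre: spectral_resolution "F u" "N u" "Q u"
    by (rule fibre_resolution[OF less(1)])
  have "(\<Sum>\<mu>\<in>composition_eigs. Q u \<mu> (x mod m) (y mod m)) = of_bool (x mod m = y mod m)"
    using less regular_fibresD(1)[OF fibres less(1)] finite_composition_eigs
    by (intro fibre.resolution_superset) (auto simp: composition_eigs_def)
  moreover have "(\<Sum>\<mu>\<in>composition_eigs. of_bool (\<mu> = real d)) = (1 :: real)"
    using finite_composition_eigs by (simp add: composition_eigs_def of_bool_def)
  moreover have "(\<Sum>\<mu>\<in>composition_eigs. P ((\<mu> - d) / m) u v) = of_bool (u = v)"
    using less by (intro sum_base_proj) simp_all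
  ultimately have "(\<Sum>\<mu>\<in>composition_eigs. composition_proj m d P Q \<mu> x y) =
      of_bool (u = v) * of_bool (x mod m = y mod m)"
    by (auto simp: composition_proj_def sum.distrib sum_subtractf simp flip: u_def v_def sum_divide_distrib)
  also have "\<dots> = of_bool (x = y)"
  proof -
    have "x = y \<longleftrightarrow> u = v \<and> x mod m = y mod m"
      unfolding u_def v_def by (metis div_mult_mod_eq)
    then show ?thesis by simp
  qed
  finally show ?thesis .
qed

lemma spectral_resolution_composition:
  "spectral_resolution (composition B m F) composition_eigs (composition_proj m d P Q)"
  using is_graph_composition[OF base.graph fibres]
  by unfold_locales (simp_all add: finite_composition_eigs composition_proj_outside composition_proj_eigen
      composition_proj_resolution)

lemma composition_resolution_permute:
  assumes "bij_betw \<pi> (verts B) (verts B)"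
  shows "composition_resolution B M P m d (F \<circ> \<pi>) (N \<circ> \<pi>) (Q \<circ> \<pi>)"
  using regular_fibres_permute[OF fibres assms] fibre_resolution bij_betwE[OF assms] base.spectral_resolution_axioms
  by (simp add: composition_resolution_def composition_resolution_axioms_def)

lemmas spectral_resolution_permute =
  composition_resolution.spectral_resolution_composition[OF composition_resolution_permute]

lemma Spec_composition_permute:
  assumes "bij_betw \<pi> (verts B) (verts B)"
  shows "Spec (composition B m (F \<circ> \<pi>)) = Spec (composition B m F)"
proof (rule Spec_eq_if_trace_eq[OF spectral_resolution_permute[OF assms] spectral_resolution_composition])
  fix \<mu> :: real
  have trace: "(\<Sum>x<fst B * m. composition_proj m d P Q' \<mu> x x) =
      (\<Sum>u<fst B. \<Sum>i<m. Q' u \<mu> i i - of_bool (\<mu> = d) / m) +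
      (\<Sum>u<fst B. \<Sum>i<m. P ((\<mu> - d) / m) u u / m)" for Q'
    unfolding sum_lessThan_mult by (simp add: composition_proj_def sum.distrib)
  have "bij_betw \<pi> {..<fst B} {..<fst B}"
    using assms by (simp add: verts_def atLeast0LessThan)
  from sum.reindex_bij_betw[OF this, of "\<lambda>u. \<Sum>i<m. Q u \<mu> i i - of_bool (\<mu> = d) / m"]
  show "(\<Sum>x<fst (composition B m (F \<circ> \<pi>)). composition_proj m d P (Q \<circ> \<pi>) \<mu> x x) =
      (\<Sum>x<fst (composition B m F). composition_proj m d P Q \<mu> x x)"
    by (simp add: trace)
qed

lemma Pstar_composition_permute_eq:
  assumes "bij_betw \<rho> (verts B) (verts B)" "bij_betw \<sigma> (verts B) (verts B)"
    and "\<rho> (x div m) = \<sigma> (x div m)" "x < fst B * m" "y < fst B * m"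
  shows "Pstar (composition B m (F \<circ> \<rho>)) x y = Pstar (composition B m (F \<circ> \<sigma>)) x y"
proof -
  have "composition_proj m d P (Q \<circ> \<rho>) \<mu> x y = composition_proj m d P (Q \<circ> \<sigma>) \<mu> x y" for \<mu>
    using assms(3) by (auto simp: composition_proj_def)
  then show ?thesis
    using spectral_resolution.Pstar_eq_iff[OF assms(1,2)[THEN spectral_resolution_permute]]
      assms(1,2)[THEN Spec_composition_permute] assms(4,5) by simp
qed

theorem F_weak_composition_permute:
  assumes "vertex_transitive B" and \<pi>: "bij_betw \<pi> (verts B) (verts B)"
  shows "F_weak (composition B m (F \<circ> \<pi>)) = F_weak (composition B m F)"
proof -
  let ?row = "\<lambda>G x. (Pstar G x x, image_mset (Pstar G x) (mset_set (verts G)))"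
  have "image_mset (?row (composition B m (F \<circ> \<pi>))) (mset_set (verts (composition B m (F \<circ> \<pi>)))) =
      image_mset (?row (composition B m F)) (mset_set (verts (composition B m F)))"
  proof (rule image_mset_composition_permute[OF assms])
    fix \<rho> \<sigma> x
    assume "bij_betw \<rho> (verts B) (verts B)" "bij_betw \<sigma> (verts B) (verts B)"
      and x: "x < fst B * m" and "\<rho> (x div m) = \<sigma> (x div m)"
    then have "Pstar (composition B m (F \<circ> \<rho>)) x y = Pstar (composition B m (F \<circ> \<sigma>)) x y" if "y < fst B * m" for y
      using that by (intro Pstar_composition_permute_eq)
    then show "?row (composition B m (F \<circ> \<rho>)) x = ?row (composition B m (F \<circ> \<sigma>)) x"
      using x by (auto simp: verts_def intro: image_mset_cong)
  next
    fix h \<sigma> x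
    assume \<sigma>: "bij_betw \<sigma> (verts B) (verts B)" and x: "x < fst B * m"
      and h: "graph_iso h (composition B m (F \<circ> \<sigma>)) (composition B m F)"
    have Pstar: "Pstar (composition B m (F \<circ> \<sigma>)) y z = Pstar (composition B m F) (h y) (h z)"
      if "y < fst B * m" "z < fst B * m" for y z
      using that spectral_resolution.graph[OF spectral_resolution_permute[OF \<sigma>]]
      by (intro Pstar_iso[OF h _ spectral_resolution_composition]) simp_all
    have "mset_set (verts (composition B m F)) = image_mset h (mset_set (verts (composition B m (F \<circ> \<sigma>))))"
      using h by (intro mset_set_bij_betw) (simp add: graph_iso_def)
    then show "?row (composition B m (F \<circ> \<sigma>)) x = ?row (composition B m F) (h x)"
      using x by (auto simp: Pstar multiset.map_comp intro!: image_mset_cong)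
  qed
  then show ?thesis
    by (simp add: F_weak_def Spec_composition_permute[OF \<pi>])
qed

end

section \<open>Hexagons and triangles\<close>

lemma image_mset_eqE:
  assumes "image_mset f M = image_mset g N" "a \<in># M"
  obtains b where "b \<in># N" "f a = g b"
proof -
  have "f a \<in># image_mset g N"
    using assms(2) by (simp flip: assms(1))
  then show thesis using that by auto
qed

lemma F_strong_eqE:
  assumes "F_strong G = F_strong H" "x < fst G" "y < fst G"
  obtains x' y' where "x' < fst H" "y' < fst H" "Pstar G x x = Pstar H x' x'"
    "Pstar G x y = Pstar H x' y'" "Pstar G y y = Pstar H y' y'"
proof -
  let ?row = "\<lambda>G x. image_mset (\<lambda>y. (Pstar G x y, Pstar G y y)) (mset_set (verts G))"
  have "image_mset (\<lambda>x. (Pstar G x x, ?row G x)) (mset_set (verts G)) =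
      image_mset (\<lambda>x. (Pstar H x x, ?row H x)) (mset_set (verts H))"
    using assms(1) by (simp add: F_strong_def)
  then obtain x' where x': "x' < fst H" "Pstar G x x = Pstar H x' x'" and "?row G x = ?row H x'"
    by (rule image_mset_eqE[of _ _ _ _ x]) (use assms(2) in auto)
  from this(3) obtain y' where "y' < fst H" "Pstar G x y = Pstar H x' y'" "Pstar G y y = Pstar H y' y'"
    by (rule image_mset_eqE[of _ _ _ _ y]) (use assms(3) in auto)
  with x' show thesis using that by blast
qed

definition two_edges :: graph where
  "two_edges = (4, \<lambda>u v. u div 2 = v div 2 \<and> u \<noteq> v)"

definition two_edges_proj :: "real \<Rightarrow> nat \<Rightarrow> nat \<Rightarrow> real" where
  "two_edges_proj \<theta> u v = of_bool (u div 2 = v div 2) *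
     (if \<theta> = 1 then 1 / 2 else if \<theta> = -1 then of_bool (u = v) - 1 / 2 else 0)"

text \<open>Vertices are adjacent iff they differ by 1 or \<open>-1\<close> modulo 6. The description modulo 2 and modulo 3
  presents the hexagon as the tensor product of \<open>K\<^sub>2\<close> and \<open>K\<^sub>3\<close>, so its projections are products, too.\<close>

definition hexagon :: graph where
  "hexagon = (6, \<lambda>i j. i mod 2 \<noteq> j mod 2 \<and> i mod 3 \<noteq> j mod 3)"

definition hexagon_proj :: "real \<Rightarrow> nat \<Rightarrow> nat \<Rightarrow> real" where
  "hexagon_proj \<mu> i j =
     (if \<mu> = 2 \<or> \<mu> = -1 then 1 / 2 else if \<mu> = -2 \<or> \<mu> = 1 then of_bool (i mod 2 = j mod 2) - 1 / 2 else 0) *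
     (if \<mu> = 2 \<or> \<mu> = -2 then 1 / 3 else of_bool (i mod 3 = j mod 3) - 1 / 3)"

definition two_triangles :: graph where
  "two_triangles = (6, \<lambda>i j. i mod 2 = j mod 2 \<and> i \<noteq> j)"

definition two_triangles_proj :: "real \<Rightarrow> nat \<Rightarrow> nat \<Rightarrow> real" where
  "two_triangles_proj \<mu> i j = of_bool (i mod 2 = j mod 2) *
     (if \<mu> = 2 then 1 / 3 else if \<mu> = -1 then of_bool (i = j) - 1 / 3 else 0)"

lemma fst_graphs [simp]: "fst two_edges = 4" "fst hexagon = 6" "fst two_triangles = 6"
  by (simp_all add: two_edges_def hexagon_def two_triangles_def)

lemma sum_lessThan_4: "(\<Sum>i<4::nat. f i) = f 0 + f 1 + f 2 + f 3" for f :: "nat \<Rightarrow> 'a :: comm_monoid_add"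
  by (simp add: lessThan_nat_numeral lessThan_Suc ac_simps)

lemma sum_lessThan_6: "(\<Sum>i<6::nat. f i) = f 0 + f 1 + f 2 + f 3 + f 4 + f 5" for f :: "nat \<Rightarrow> 'a :: comm_monoid_add"
  by (simp add: lessThan_nat_numeral lessThan_Suc ac_simps)

lemma less_4_cases: "(u::nat) < 4 \<Longrightarrow> u = 0 \<or> u = 1 \<or> u = 2 \<or> u = 3"
  by linarith

lemma less_6_cases: "(i::nat) < 6 \<Longrightarrow> i = 0 \<or> i = 1 \<or> i = 2 \<or> i = 3 \<or> i = 4 \<or> i = 5"
  by linarith

lemma is_graph_two_edges: "is_graph two_edges"
  by (auto simp: is_graph_def two_edges_def)

lemma vertex_transitive_two_edges: "vertex_transitive two_edges"
  unfolding vertex_transitive_def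
proof (intro ballI)
  include bit_operations_syntax
  fix u v assume "u \<in> verts two_edges" "v \<in> verts two_edges"
  then have uv: "u < 4" "v < 4" by simp_all
  define \<sigma> where "\<sigma> w = w XOR (u XOR v)" for w
  have less: "\<sigma> w < 4" if "w < 4" for w
    using less_4_cases[OF uv(1)] less_4_cases[OF uv(2)] less_4_cases[OF that]
    by (elim disjE) (simp_all add: \<sigma>_def)
  have "bij_betw \<sigma> (verts two_edges) (verts two_edges)"
    by (rule bij_betw_byWitness[where f' = \<sigma>]) (auto simp: less, simp_all add: \<sigma>_def xor.assoc)
  moreover have "\<sigma> w = \<sigma> z \<longleftrightarrow> w = z" "\<sigma> w div 2 = \<sigma> z div 2 \<longleftrightarrow> w div 2 = z div 2" for w z
  proof -
    have cancel: "a XOR c = b XOR c \<longleftrightarrow> a = b" for a b c :: nat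
      by (metis xor.assoc xor.right_neutral xor_self_eq)
    moreover have "(a XOR c) div 2 = (a div 2) XOR (c div 2)" for a c :: nat
      by (subst xor_rec) simp
    ultimately show "\<sigma> w = \<sigma> z \<longleftrightarrow> w = z" "\<sigma> w div 2 = \<sigma> z div 2 \<longleftrightarrow> w div 2 = z div 2"
      by (simp_all add: \<sigma>_def)
  qed
  ultimately have "graph_iso \<sigma> two_edges two_edges"
    unfolding graph_iso_def by (simp add: two_edges_def)
  moreover have "\<sigma> u = v" by (simp add: \<sigma>_def flip: xor.assoc)
  ultimately show "\<exists>\<sigma>. graph_iso \<sigma> two_edges two_edges \<and> \<sigma> u = v" by blast
qed

lemma is_regular_hexagon: "is_regular 2 hexagon"
proof -
  have "is_graph hexagon"
    by (auto simp: is_graph_def hexagon_def)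
  moreover have "card (nbrs hexagon i) = 2" if "i < 6" for i
    using less_6_cases[OF that] by (elim disjE) (simp_all add: card_nbrs sum_lessThan_6 hexagon_def)
  ultimately show ?thesis by (simp add: is_regular_def)
qed

lemma is_regular_two_triangles: "is_regular 2 two_triangles"
proof -
  have "is_graph two_triangles"
    by (auto simp: is_graph_def two_triangles_def)
  moreover have "card (nbrs two_triangles i) = 2" if "i < 6" for i
    using less_6_cases[OF that] by (elim disjE) (simp_all add: card_nbrs sum_lessThan_6 two_triangles_def)
  ultimately show ?thesis by (simp add: is_regular_def)
qed

lemma spectral_resolution_two_edges: "spectral_resolution two_edges {-1, 1} two_edges_proj"
proof
  fix \<theta> u v assume "u < fst two_edges" "v < fst two_edges"
  then have "u < 4" "v < 4" by simp_all
  from this[THEN less_4_cases]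
  show "(\<Sum>w\<in>nbrs two_edges u. two_edges_proj \<theta> w v) = \<theta> * two_edges_proj \<theta> u v"
    unfolding sum_nbrs by (elim disjE) (simp_all add: sum_lessThan_4 two_edges_def two_edges_proj_def)
  show "(\<Sum>\<theta>\<in>{-1, 1}. two_edges_proj \<theta> u v) = of_bool (u = v)"
    by (auto simp: two_edges_proj_def)
qed (simp_all add: is_graph_two_edges two_edges_proj_def)

lemma spectral_resolution_hexagon: "spectral_resolution hexagon {-2, -1, 1, 2} hexagon_proj"
proof
  fix \<mu> i j assume "i < fst hexagon" "j < fst hexagon"
  then have "i < 6" "j < 6" by simp_all
  note cases = this[THEN less_6_cases]
  from cases show "(\<Sum>k\<in>nbrs hexagon i. hexagon_proj \<mu> k j) = \<mu> * hexagon_proj \<mu> i j"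
    unfolding sum_nbrs by (elim disjE) (simp_all add: sum_lessThan_6 hexagon_def hexagon_proj_def)
  from cases show "(\<Sum>\<mu>\<in>{-2, -1, 1, 2}. hexagon_proj \<mu> i j) = of_bool (i = j)"
    by (elim disjE) (simp_all add: hexagon_proj_def)
qed (use is_regular_hexagon in \<open>simp_all add: is_regular_def hexagon_proj_def\<close>)

lemma spectral_resolution_two_triangles: "spectral_resolution two_triangles {-1, 2} two_triangles_proj"
proof
  fix \<mu> i j assume "i < fst two_triangles" "j < fst two_triangles"
  then have "i < 6" "j < 6" by simp_all
  from this[THEN less_6_cases]
  show "(\<Sum>k\<in>nbrs two_triangles i. two_triangles_proj \<mu> k j) = \<mu> * two_triangles_proj \<mu> i j"
    unfolding sum_nbrs by (elim disjE) (simp_all add: sum_lessThan_6 two_triangles_def two_triangles_proj_def)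
  show "(\<Sum>\<mu>\<in>{-1, 2}. two_triangles_proj \<mu> i j) = of_bool (i = j)"
    by (auto simp: two_triangles_proj_def)
qed (use is_regular_two_triangles in \<open>simp_all add: is_regular_def two_triangles_proj_def\<close>)

definition homogeneous_fibres :: "nat \<Rightarrow> graph" where
  "homogeneous_fibres u = (if u < 2 then hexagon else two_triangles)"

definition homogeneous_fibres_proj :: "nat \<Rightarrow> real \<Rightarrow> nat \<Rightarrow> nat \<Rightarrow> real" where
  "homogeneous_fibres_proj u = (if u < 2 then hexagon_proj else two_triangles_proj)"

definition mixing_permutation :: "nat \<Rightarrow> nat" where
  "mixing_permutation = Transposition.transpose 1 2"

lemma bij_betw_mixing_permutation: "bij_betw mixing_permutation (verts two_edges) (verts two_edges)"
  by (simp add: mixing_permutation_def)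

lemma regular_fibres_homogeneous: "regular_fibres two_edges 6 2 homogeneous_fibres"
  by (simp add: regular_fibres_def homogeneous_fibres_def is_regular_hexagon is_regular_two_triangles)

interpretation homogeneous: composition_resolution two_edges "{-1, 1}" two_edges_proj 6 2 homogeneous_fibres
  "\<lambda>u. if u < 2 then {-2, -1, 1, 2} else {-1, 2}" homogeneous_fibres_proj
  using spectral_resolution_two_edges regular_fibres_homogeneous
  by (simp add: composition_resolution_def composition_resolution_axioms_def homogeneous_fibres_def
      homogeneous_fibres_proj_def spectral_resolution_hexagon spectral_resolution_two_triangles)

abbreviation homogeneous_graph :: graph where
  "homogeneous_graph \<equiv> composition two_edges 6 homogeneous_fibres"

abbreviation mixed_graph :: graph where
  "mixed_graph \<equiv> composition two_edges 6 (homogeneous_fibres \<circ> mixing_permutation)"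

text \<open>The eigenvalue \<open>8 = 2 + 6 * 1\<close> comes from the eigenvalue 1 of \<open>two_edges\<close>, the eigenvalue 1 from the
  hexagons only.\<close>

lemma composition_proj_entries:
  fixes \<pi> :: "nat \<Rightarrow> nat"
  defines "P \<equiv> composition_proj 6 2 two_edges_proj (homogeneous_fibres_proj \<circ> \<pi>)"
  shows "P 8 x y = of_bool (x div 6 div 2 = y div 6 div 2) / 12"
    and "P 1 x x = of_bool (\<pi> (x div 6) < 2) / 3"
  by (simp_all add: P_def composition_proj_def two_edges_proj_def homogeneous_fibres_proj_def hexagon_proj_def
      two_triangles_proj_def)

lemma F_strong_mixed_neq_homogeneous: "F_strong mixed_graph \<noteq> F_strong homogeneous_graph"
proof
  define P where "P \<pi> = composition_proj 6 2 two_edges_proj (homogeneous_fibres_proj \<circ> \<pi>)" for \<pi>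
  note bij = bij_betw_mixing_permutation
  note Pstar_eq_iff = spectral_resolution.Pstar_eq_iff[OF homogeneous.spectral_resolution_permute[OF bij]
      homogeneous.spectral_resolution_composition homogeneous.Spec_composition_permute[OF bij]]
  assume "F_strong mixed_graph = F_strong homogeneous_graph"
  then obtain x y where "x < 24" "y < 24" "Pstar mixed_graph 0 0 = Pstar homogeneous_graph x x"
    "Pstar mixed_graph 0 6 = Pstar homogeneous_graph x y" "Pstar mixed_graph 6 6 = Pstar homogeneous_graph y y"
    by (rule F_strong_eqE[of _ _ 0 6]) simp_all
  then have "P mixing_permutation 1 0 0 = P id 1 x x" "P mixing_permutation 8 0 6 = P id 8 x y"
    "P mixing_permutation 1 6 6 = P id 1 y y"
    by (simp_all add: Pstar_eq_iff P_def)
  then have "x div 6 < 2" "x div 6 div 2 = y div 6 div 2" "\<not> y div 6 < 2"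
    unfolding P_def composition_proj_entries by (simp_all add: mixing_permutation_def split: if_splits)
  then show False by simp
qed

theorem theorem6p1:
  shows "(\<exists>G H. is_graph G \<and> is_graph H \<and> WL32 G = WL32 H \<and> F_strong G \<noteq> F_strong H) \<and>
         (\<exists>G H. is_graph G \<and> is_graph H \<and> F_weak G = F_weak H \<and> F_strong G \<noteq> F_strong H)"
proof -
  note mixing = regular_fibres_homogeneous bij_betw_mixing_permutation
  have "is_graph homogeneous_graph"
    by (rule is_graph_composition[OF is_graph_two_edges mixing(1)])
  moreover have "is_graph mixed_graph"
    by (rule is_graph_composition[OF is_graph_two_edges regular_fibres_permute[OF mixing]])
  moreover have "WL32 mixed_graph = WL32 homogeneous_graph"
    by (rule WL32_composition_permute[OF is_graph_two_edges vertex_transitive_two_edges mixing])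
  moreover have "F_weak mixed_graph = F_weak homogeneous_graph"
    by (rule homogeneous.F_weak_composition_permute[OF vertex_transitive_two_edges mixing(2)])
  ultimately show ?thesis
    using F_strong_mixed_neq_homogeneous by blast
qed

end
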